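(* Let $\mathcal X$ be a separable metric space, let $\mathcal K(1)\subset\mathcal K(2)\subset\cdots$ be an ascending chain of compact groups, and let $\mathcal K=\varinjlim\mathcal K(n)$ be the corresponding inductive limit topological group. Assume that there is a jointly continuous action $(u,x)\mapsto u\cdot x$ of $\mathcal K$ on $\mathcal X$. Let $\nu$ be an ergodic $\mathcal K$-invariant Borel probability measure on $\mathcal X$. Then there exists a point $x\in\mathcal X$ such that $m_n(x)\Rightarrow\nu$ (weak convergence) as $n\to\infty$. Moreover, the set of all points $x\in\mathcal X$ with this property is of full measure with respect to $\nu$.
   Context: For each $n$, $m_n$ denotes the normalized Haar measure on $\mathcal K(n)$; for $x\in\mathcal X$, $m_n(x)$ denotes the image of $m_n$ under the mapping $\mathcal K(n)\to\mathcal X$, $u\mapsto u\cdot x$, i.e. the unique $\mathcal K(n)$-invariant Borel probability measure supported by the orbit $\mathcal K(n)\cdot x$. A sequence $\nu_n$ of Borel probability measures on $\mathcal X$ converges weakly to $\nu$ (notation $\nu_n\Rightarrow\nu$) if $\int\psi\,d\nu_n\to\int\psi\,d\nu$ for every bounded continuous function $\psi$ on $\mathcal X$. A $\mathcal K$-invariant Borel probability measure $\nu$ is ergodic if every Borel set $Y\subset\mathcal X$ such that $\nu((u\cdot Y)\,\triangle\,Y)=0$ for all $u\in\mathcal K$ satisfies $\nu(Y)\in\{0,1\}$. *)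

theory Defs
  imports "HOL-Probability.Probability" "HOL-Algebra.Group_Action"
begin

definition compact_group :: "('g, 'b) monoid_scheme \<Rightarrow> 'g topology \<Rightarrow> bool" where
  "compact_group G T \<longleftrightarrow>
     group G \<and> topspace T = carrier G \<and>
     continuous_map (prod_topology T T) T (\<lambda>(u, v). u \<otimes>\<^bsub>G\<^esub> v) \<and>
     continuous_map T T (\<lambda>u. inv\<^bsub>G\<^esub> u) \<and>
     compact_space T \<and> Hausdorff_space T"

text \<open>Each group is a subgroup of its successor and carries the subspace topology.  The group
  operation of a record is unconstrained off its carrier, so the operations are only compared
  on the smaller carrier.\<close>

definition ascending_chain_of_compact_groups ::
  "(nat \<Rightarrow> ('g, 'b) monoid_scheme) \<Rightarrow> (nat \<Rightarrow> 'g topology) \<Rightarrow> bool" where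
  "ascending_chain_of_compact_groups K T \<longleftrightarrow>
     (\<forall>n. compact_group (K n) (T n)) \<and>
     (\<forall>n. carrier (K n) \<subseteq> carrier (K (Suc n)) \<and>
          (\<forall>u\<in>carrier (K n). \<forall>v\<in>carrier (K n). u \<otimes>\<^bsub>K n\<^esub> v = u \<otimes>\<^bsub>K (Suc n)\<^esub> v) \<and>
          T n = subtopology (T (Suc n)) (carrier (K n)))"

text \<open>A product in the limit is computed in the first group containing both factors; by
  coherence of the chain any later group gives the same result, see
  \<open>mult_inductive_limit_group\<close> below.\<close>

definition inductive_limit_group :: "(nat \<Rightarrow> ('g, 'b) monoid_scheme) \<Rightarrow> 'g monoid" where
  "inductive_limit_group K =
     \<lparr>carrier = (\<Union>n. carrier (K n)),
      mult = (\<lambda>u v. u \<otimes>\<^bsub>K (LEAST n. u \<in> carrier (K n) \<and> v \<in> carrier (K n))\<^esub> v),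
      one = \<one>\<^bsub>K 0\<^esub>\<rparr>"

text \<open>The final topology with respect to the inclusions of the \<open>T n\<close>.\<close>

definition inductive_limit_topology :: "(nat \<Rightarrow> 'g topology) \<Rightarrow> 'g topology" where
  "inductive_limit_topology T =
     topology (\<lambda>U. U \<subseteq> (\<Union>n. topspace (T n)) \<and> (\<forall>n. openin (T n) (U \<inter> topspace (T n))))"

definition continuous_action ::
  "('g, 'b) monoid_scheme \<Rightarrow> 'g topology \<Rightarrow> ('g \<Rightarrow> 'x::topological_space \<Rightarrow> 'x) \<Rightarrow> bool" where
  "continuous_action G T act \<longleftrightarrow>
     group_action G UNIV act \<and>
     continuous_map (prod_topology T euclidean) euclidean (\<lambda>(u, x). act u x)"

text \<open>The left Haar measure of total mass one, as a regular Borel measure.  Outer regularity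
  suffices, since in a compact space it yields inner regularity by passing to complements.\<close>

definition normalized_haar_measure ::
  "('g, 'b) monoid_scheme \<Rightarrow> 'g topology \<Rightarrow> 'g measure \<Rightarrow> bool" where
  "normalized_haar_measure G T m \<longleftrightarrow>
     prob_space m \<and>
     space m = carrier G \<and>
     sets m = sigma_sets (carrier G) {U. openin T U} \<and>
     (\<forall>u\<in>carrier G. \<forall>A\<in>sets m. emeasure m (u <#\<^bsub>G\<^esub> A) = emeasure m A) \<and>
     (\<forall>A\<in>sets m. emeasure m A = (INF U\<in>{U. openin T U \<and> A \<subseteq> U}. emeasure m U))"

definition orbital_measure ::
  "'g measure \<Rightarrow> ('g \<Rightarrow> 'x::topological_space \<Rightarrow> 'x) \<Rightarrow> 'x \<Rightarrow> 'x measure" where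
  "orbital_measure m act x = distr m borel (\<lambda>u. act u x)"

definition borel_probability_measure :: "'x::topological_space measure \<Rightarrow> bool" where
  "borel_probability_measure \<nu> \<longleftrightarrow> sets \<nu> = sets borel \<and> prob_space \<nu>"

definition weakly_converges ::
  "(nat \<Rightarrow> 'x::topological_space measure) \<Rightarrow> 'x measure \<Rightarrow> bool" where
  "weakly_converges \<nu>s \<nu> \<longleftrightarrow>
     (\<forall>\<psi> :: 'x \<Rightarrow> real. continuous_on UNIV \<psi> \<and> bounded (range \<psi>) \<longrightarrow>
        (\<lambda>n. integral\<^sup>L (\<nu>s n) \<psi>) \<longlonglongrightarrow> integral\<^sup>L \<nu> \<psi>)"

definition invariant_measure ::
  "('g, 'b) monoid_scheme \<Rightarrow> ('g \<Rightarrow> 'x \<Rightarrow> 'x) \<Rightarrow> 'x measure \<Rightarrow> bool" where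
  "invariant_measure G act \<nu> \<longleftrightarrow>
     (\<forall>u\<in>carrier G. \<forall>Y\<in>sets \<nu>. emeasure \<nu> (act u ` Y) = emeasure \<nu> Y)"

definition ergodic_measure ::
  "('g, 'b) monoid_scheme \<Rightarrow> ('g \<Rightarrow> 'x \<Rightarrow> 'x) \<Rightarrow> 'x measure \<Rightarrow> bool" where
  "ergodic_measure G act \<nu> \<longleftrightarrow>
     (\<forall>Y\<in>sets \<nu>. (\<forall>u\<in>carrier G. measure \<nu> (sym_diff (act u ` Y) Y) = 0) \<longrightarrow>
        measure \<nu> Y = 0 \<or> measure \<nu> Y = 1)"


lemma openin_inductive_limit_topology:
  "openin (inductive_limit_topology T) U \<longleftrightarrow>
     U \<subseteq> (\<Union>n. topspace (T n)) \<and> (\<forall>n. openin (T n) (U \<inter> topspace (T n)))"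
proof -
  have "istopology (\<lambda>U. U \<subseteq> (\<Union>n. topspace (T n)) \<and> (\<forall>n. openin (T n) (U \<inter> topspace (T n))))"
    unfolding istopology_def
  proof (intro conjI allI impI)
    fix A B n
    assume "A \<subseteq> (\<Union>n. topspace (T n)) \<and> (\<forall>n. openin (T n) (A \<inter> topspace (T n)))"
      and "B \<subseteq> (\<Union>n. topspace (T n)) \<and> (\<forall>n. openin (T n) (B \<inter> topspace (T n)))"
    then have "openin (T n) ((A \<inter> topspace (T n)) \<inter> (B \<inter> topspace (T n)))" by blast
    then show "openin (T n) (A \<inter> B \<inter> topspace (T n))"
      by (simp add: inf_assoc inf_left_commute)
  next
    fix \<C> n
    assume "\<forall>C\<in>\<C>. C \<subseteq> (\<Union>n. topspace (T n)) \<and> (\<forall>n. openin (T n) (C \<inter> topspace (T n)))"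
    then have "openin (T n) (\<Union>C\<in>\<C>. C \<inter> topspace (T n))" by blast
    then show "openin (T n) (\<Union>\<C> \<inter> topspace (T n))" by (simp add: Int_commute)
  qed blast+
  then show ?thesis
    unfolding inductive_limit_topology_def by simp
qed

lemma chain_mono:
  assumes "ascending_chain_of_compact_groups K T" "m \<le> n"
  shows "carrier (K m) \<subseteq> carrier (K n)"
    and "u \<in> carrier (K m) \<Longrightarrow> v \<in> carrier (K m) \<Longrightarrow> u \<otimes>\<^bsub>K m\<^esub> v = u \<otimes>\<^bsub>K n\<^esub> v"
  using assms(2)
proof (induction rule: dec_induct)
  case (step n)
  {
    case 1
    show ?case using step assms(1) unfolding ascending_chain_of_compact_groups_def by blast
  next
    case 2
    then have "u \<in> carrier (K n)" "v \<in> carrier (K n)" using step by auto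
    with 2 step assms(1) show ?case unfolding ascending_chain_of_compact_groups_def by metis
  }
qed auto

lemma mult_inductive_limit_group:
  assumes "ascending_chain_of_compact_groups K T" "u \<in> carrier (K n)" "v \<in> carrier (K n)"
  shows "u \<otimes>\<^bsub>inductive_limit_group K\<^esub> v = u \<otimes>\<^bsub>K n\<^esub> v"
proof -
  define l where "l = (LEAST n. u \<in> carrier (K n) \<and> v \<in> carrier (K n))"
  have "u \<in> carrier (K l) \<and> v \<in> carrier (K l)" "l \<le> n"
    using assms LeastI[of "\<lambda>n. u \<in> carrier (K n) \<and> v \<in> carrier (K n)" n]
      Least_le[of "\<lambda>n. u \<in> carrier (K n) \<and> v \<in> carrier (K n)" n]
    unfolding l_def by auto
  then show ?thesis
    using chain_mono(2)[OF assms(1), of l n u v]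
    unfolding inductive_limit_group_def l_def by auto
qed

lemma group_inductive_limit_group:
  assumes chain: "ascending_chain_of_compact_groups K T"
  shows "group (inductive_limit_group K)"
proof (rule groupI)
  let ?L = "inductive_limit_group K"
  have grp: "group (K n)" for n
    using chain unfolding ascending_chain_of_compact_groups_def compact_group_def by blast
  have car: "carrier ?L = (\<Union>n. carrier (K n))" and one: "\<one>\<^bsub>?L\<^esub> = \<one>\<^bsub>K 0\<^esub>"
    by (simp_all add: inductive_limit_group_def)
  note sub = chain_mono(1)[OF chain]
  note mult = mult_inductive_limit_group[OF chain]
  have one_n: "\<one>\<^bsub>K n\<^esub> = \<one>\<^bsub>K 0\<^esub>" for n
  proof -
    have z: "\<one>\<^bsub>K 0\<^esub> \<in> carrier (K 0)" "\<one>\<^bsub>K 0\<^esub> \<otimes>\<^bsub>K 0\<^esub> \<one>\<^bsub>K 0\<^esub> = \<one>\<^bsub>K 0\<^esub>"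
      using grp[of 0] by (simp_all add: group.is_monoid monoid.one_closed monoid.l_one)
    then have "\<one>\<^bsub>K 0\<^esub> \<otimes>\<^bsub>K n\<^esub> \<one>\<^bsub>K 0\<^esub> = \<one>\<^bsub>K 0\<^esub>" "\<one>\<^bsub>K 0\<^esub> \<in> carrier (K n)"
      using chain_mono(2)[OF chain, of 0 n] sub[of 0 n] by auto
    then show ?thesis using group.l_cancel_one'[OF grp[of n]] by metis
  qed
  have join: "\<exists>n. u \<in> carrier (K n) \<and> v \<in> carrier (K n)"
    if uv: "u \<in> carrier ?L" "v \<in> carrier ?L" for u v
  proof -
    obtain i j where "u \<in> carrier (K i)" "v \<in> carrier (K j)" using uv by (auto simp: car)
    then have "u \<in> carrier (K (max i j)) \<and> v \<in> carrier (K (max i j))"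
      using sub[of i "max i j"] sub[of j "max i j"] by auto
    then show ?thesis by blast
  qed
  have join3: "\<exists>n. u \<in> carrier (K n) \<and> v \<in> carrier (K n) \<and> w \<in> carrier (K n)"
    if uvw: "u \<in> carrier ?L" "v \<in> carrier ?L" "w \<in> carrier ?L" for u v w
  proof -
    obtain i j where "u \<in> carrier (K i) \<and> v \<in> carrier (K i)" "w \<in> carrier (K j)"
      using join[OF uvw(1,2)] uvw(3) by (auto simp: car)
    then have "u \<in> carrier (K (max i j)) \<and> v \<in> carrier (K (max i j)) \<and> w \<in> carrier (K (max i j))"
      using sub[of i "max i j"] sub[of j "max i j"] by auto
    then show ?thesis by blast
  qed
  have closed: "u \<otimes>\<^bsub>K n\<^esub> v \<in> carrier (K n)" if "u \<in> carrier (K n)" "v \<in> carrier (K n)" for n u v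
    using that grp[of n] by (simp add: group.is_monoid monoid.m_closed)
  show "\<one>\<^bsub>?L\<^esub> \<in> carrier ?L"
    using grp[of 0] unfolding car one by (auto intro: group.is_monoid monoid.one_closed)
  fix u v w assume u: "u \<in> carrier ?L"
  then obtain k where k: "u \<in> carrier (K k)" by (auto simp: car)
  have "\<one>\<^bsub>K k\<^esub> \<in> carrier (K k)" using grp[of k] by (simp add: group.is_monoid monoid.one_closed)
  then show "\<one>\<^bsub>?L\<^esub> \<otimes>\<^bsub>?L\<^esub> u = u"
    using mult[of "\<one>\<^bsub>K k\<^esub>" k u] k monoid.l_one[OF group.is_monoid[OF grp[of k]] k]
    unfolding one one_n[of k] by simp
  have "inv\<^bsub>K k\<^esub> u \<in> carrier (K k)" "inv\<^bsub>K k\<^esub> u \<otimes>\<^bsub>K k\<^esub> u = \<one>\<^bsub>K k\<^esub>"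
    using group.inv_closed[OF grp k] group.l_inv[OF grp k] by auto
  then show "\<exists>y\<in>carrier ?L. y \<otimes>\<^bsub>?L\<^esub> u = \<one>\<^bsub>?L\<^esub>"
    using mult[of "inv\<^bsub>K k\<^esub> u" k u] k unfolding one one_n[of k] car by auto
  assume v: "v \<in> carrier ?L"
  obtain n where n: "u \<in> carrier (K n)" "v \<in> carrier (K n)" using join[OF u v] by blast
  show "u \<otimes>\<^bsub>?L\<^esub> v \<in> carrier ?L"
    using mult[OF n(1,2)] closed[OF n(1,2)] unfolding car by auto
  assume w: "w \<in> carrier ?L"
  obtain n where n: "u \<in> carrier (K n)" "v \<in> carrier (K n)" "w \<in> carrier (K n)"
    using join3[OF u v w] by blast
  show "u \<otimes>\<^bsub>?L\<^esub> v \<otimes>\<^bsub>?L\<^esub> w = u \<otimes>\<^bsub>?L\<^esub> (v \<otimes>\<^bsub>?L\<^esub> w)"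
    using n mult[of _ n] closed[of _ n] monoid.m_assoc[OF group.is_monoid[OF grp[of n]] n] by simp
qed

end

theory Submission
  imports Defs
begin

text \<open>For bounded \<open>f\<close> the averages \<open>P\<^sub>n f x = \<integral> f (u \<cdot> x) dm\<^sub>n(u)\<close> form a reverse
  martingale: they are the conditional expectations of \<open>f\<close> given the \<open>\<K>(n)\<close>-invariant sets.
  The reverse martingale convergence theorem is not needed, because a maximal inequality suffices
  under ergodicity.  If \<open>\<integral> f d\<nu> < 0\<close>, the set where \<open>P\<^sub>n f > 0\<close> infinitely often is
  \<open>\<K>\<close>-invariant; were it of full measure, the maximal inequality would give
  \<open>\<integral> f d\<nu> \<ge> 0\<close>, so it is null.  Shifting \<open>f\<close> and \<open>- f\<close> by constants gives
  \<open>P\<^sub>n f \<rightarrow> \<integral> f d\<nu>\<close> almost everywhere, and countably many continuous functions, finite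
  maxima of cones with rational data, decide weak convergence.\<close>

subsection \<open>A countable convergence-determining family\<close>

lemma separable_euclidean_dense_sequence:
  assumes "separable_space (euclidean :: 'x::metric_space topology)"
  obtains d :: "nat \<Rightarrow> 'x::metric_space" where "\<And>x e. e > 0 \<Longrightarrow> \<exists>i. dist x (d i) < e"
proof -
  obtain C :: "'x set" where C: "countable C" "closure C = UNIV"
    using assms unfolding separable_space_def by auto
  then have "C \<noteq> {}" by auto
  then have d: "range (from_nat_into C) = C" using C(1) by (rule range_from_nat_into)
  show ?thesis
  proof
    fix x :: 'x and e :: real assume "e > 0"
    then obtain y where "y \<in> C" "dist y x < e"
      using C(2) closure_approachable[of x C] by auto
    then show "\<exists>i. dist x (from_nat_into C i) < e" using d by (metis dist_commute imageE)
  qed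
qed

text \<open>A nonnegative continuous function is thus the pointwise supremum of those members of a
  fixed countable family that lie below it. The family consists of truncated cones: by continuity, a
  sufficiently narrow cone centred near \<open>y\<close> stays below \<open>\<psi>\<close> and still
  exceeds \<open>c\<close> at \<open>y\<close>.\<close>

lemma countable_lower_approximation:
  assumes "separable_space (euclidean :: 'x::metric_space topology)"
  obtains h :: "nat \<Rightarrow> 'x::metric_space \<Rightarrow> real" where
    "\<And>i. continuous_on UNIV (h i)" "\<And>i. bounded (range (h i))"
    "\<And>\<psi> y c. \<lbrakk>continuous_on UNIV \<psi>; \<And>x. 0 \<le> \<psi> x; c < \<psi> y\<rbrakk> \<Longrightarrow> \<exists>i. (\<forall>x. h i x \<le> \<psi> x) \<and> c < h i y"
proof -
  obtain d :: "nat \<Rightarrow> 'x" where d: "\<And>x e. e > 0 \<Longrightarrow> \<exists>i. dist x (d i) < e"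
    using separable_euclidean_dense_sequence[OF assms] by blast
  \<comment> \<open>Rational heights, natural slopes and centres in a dense sequence keep the family
    countable. Truncation at 0 makes each cone bounded and is harmless below a nonnegative
    function.\<close>
  define cone where "cone = (\<lambda>(i, q :: rat, r :: nat) x. max 0 (of_rat q - real r * dist x (d i)))"
  show ?thesis
  proof
    fix n :: nat
    obtain i q r where n: "(from_nat n :: nat \<times> rat \<times> nat) = (i, q, r)" by (metis prod_cases3)
    show "continuous_on UNIV (cone (from_nat n))"
      unfolding cone_def n prod.case by (intro continuous_intros)
    have "\<bar>cone (from_nat n) x\<bar> \<le> \<bar>of_rat q :: real\<bar>" for x
    proof -
      have "0 \<le> real r * dist x (d i)" by simp
      then show ?thesis unfolding cone_def n prod.case by arith
    qed
    then show "bounded (range (cone (from_nat n)))" by (auto intro!: boundedI)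
  next
    fix \<psi> :: "'x \<Rightarrow> real" and y :: 'x and c :: real
    assume cont: "continuous_on UNIV \<psi>" and nonneg: "\<And>x. 0 \<le> \<psi> x" and c: "c < \<psi> y"
    have "\<exists>p. (\<forall>x. cone p x \<le> \<psi> x) \<and> c < cone p y"
    proof (cases "c < 0")
      case True
      \<comment> \<open>The cone of height and slope 0 is the zero function.\<close>
      then have "(\<forall>x. cone (0, 0, 0) x \<le> \<psi> x) \<and> c < cone (0, 0, 0) y"
        using nonneg by (simp add: cone_def)
      then show ?thesis by blast
    next
      case False
      obtain q where q: "c < of_rat q" "of_rat q < \<psi> y" using of_rat_dense[OF c] by blast
      have "eventually (\<lambda>x. of_rat q < \<psi> x) (at y)"
        using cont q(2) by (auto simp: continuous_on_def dest!: order_tendstoD(1))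
      then obtain \<delta> where \<delta>: "\<delta> > 0" "\<And>x. dist x y < \<delta> \<Longrightarrow> of_rat q < \<psi> x"
        using q(2) unfolding eventually_at by (metis UNIV_I)
      \<comment> \<open>This slope gives the cone the radius \<open>of_rat q / real r\<close>, less
        than \<open>\<delta> / 2\<close>.\<close>
      obtain r :: nat where r: "2 * of_rat q / \<delta> < real r" using reals_Archimedean2 by blast
      moreover have "(0 :: real) < of_rat q" using q(1) False by linarith
      then have "0 < 2 * of_rat q / \<delta>" using \<delta>(1) by (intro divide_pos_pos mult_pos_pos) simp_all
      ultimately have r0: "0 < real r" by linarith
      \<comment> \<open>A centre within \<open>\<delta> / 2\<close> of \<open>y\<close> makes the
        cone vanish outside the ball of radius \<open>\<delta>\<close> around \<open>y\<close>. The
        second bound keeps the loss of height at \<open>y\<close> below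
        \<open>of_rat q - c\<close>.\<close>
      obtain i where i: "dist y (d i) < min (\<delta> / 2) ((of_rat q - c) / real r)"
        using d[of "min (\<delta> / 2) ((of_rat q - c) / real r)" y] \<delta>(1) q(1) r0 by auto
      have "cone (i, q, r) x \<le> \<psi> x" for x
      proof (cases "real r * dist x (d i) < of_rat q")
        case True
        then have "real r * dist x (d i) < real r * (\<delta> / 2)" using r \<delta>(1) by (simp add: field_simps)
        then have "dist x (d i) < \<delta> / 2" using r0 by simp
        then have "dist x y < \<delta>" using i dist_triangle2[of x y "d i"] by simp
        then have "of_rat q < \<psi> x" by (rule \<delta>(2))
        moreover have "0 \<le> real r * dist x (d i)" by simp
        ultimately show ?thesis
          using nonneg[of x] unfolding cone_def prod.case by arith
      qed (use nonneg[of x] in \<open>simp add: cone_def\<close>)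
      moreover have "real r * dist y (d i) < of_rat q - c" using i r0 by (simp add: field_simps)
      then have "c < cone (i, q, r) y" unfolding cone_def by (simp add: max_def)
      ultimately show ?thesis by blast
    qed
    then show "\<exists>i. (\<forall>x. cone (from_nat i) x \<le> \<psi> x) \<and> c < cone (from_nat i) y"
      by (metis from_nat_to_nat)
  qed
qed

text \<open>Finite maxima of the lower approximants increase to any nonnegative bounded continuous
  function. Convergence on these maxima therefore bounds the lower limit of the integrals from
  below. Applied to \<open>b + \<psi>\<close> and \<open>b - \<psi>\<close>, with \<open>b\<close> a
  bound of \<open>\<bar>\<psi>\<bar>\<close>, this gives both halves of the convergence.\<close>

lemma countable_weak_convergence_test:
  assumes "separable_space (euclidean :: 'x::metric_space topology)"
  obtains F :: "nat \<Rightarrow> 'x::metric_space \<Rightarrow> real" where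
    "\<And>i. continuous_on UNIV (F i)" "\<And>i. bounded (range (F i))"
    "\<And>\<nu>s \<nu>. \<lbrakk>\<And>n. borel_probability_measure (\<nu>s n); borel_probability_measure \<nu>;
        \<And>i. (\<lambda>n. integral\<^sup>L (\<nu>s n) (F i)) \<longlonglongrightarrow> integral\<^sup>L \<nu> (F i)\<rbrakk> \<Longrightarrow> weakly_converges \<nu>s \<nu>"
proof -
  obtain h :: "nat \<Rightarrow> 'x \<Rightarrow> real" where
    h_cont: "\<And>i. continuous_on UNIV (h i)" and h_bdd: "\<And>i. bounded (range (h i))" and
    h_approx: "\<And>\<psi> y c. \<lbrakk>continuous_on UNIV \<psi>; \<And>x. 0 \<le> \<psi> x; c < \<psi> y\<rbrakk> \<Longrightarrow>
      \<exists>i. (\<forall>x. h i x \<le> \<psi> x) \<and> c < h i y"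
    using countable_lower_approximation[OF assms] by metis
  \<comment> \<open>Starting the fold at 0 makes every maximum nonnegative and assigns the zero
    function to the empty list.\<close>
  define sup_h where "sup_h l x = foldr (\<lambda>i. max (h i x)) l 0" for l x
  have cont: "continuous_on UNIV (sup_h l)" for l
    unfolding sup_h_def by (induction l) (auto intro!: continuous_intros h_cont)
  have nonneg: "0 \<le> sup_h l x" for l x
    unfolding sup_h_def by (induction l) auto
  have upper: "h i x \<le> sup_h l x" if "i \<in> set l" for i l x
    using that unfolding sup_h_def by (induction l) (auto simp: le_max_iff_disj)
  have least: "sup_h l x \<le> b" if "\<And>i. i \<in> set l \<Longrightarrow> h i x \<le> b" "0 \<le> b" for l x b
    using that unfolding sup_h_def by (induction l) auto
  have bdd: "bounded (range (sup_h l))" for l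
  proof -
    have "\<exists>b. \<forall>i\<in>set l. \<forall>x. h i x \<le> b"
    proof (induction l)
      case (Cons i l)
      then obtain b where "\<forall>i\<in>set l. \<forall>x. h i x \<le> b" by blast
      moreover obtain a where "\<And>x. h i x \<le> a"
        using h_bdd[of i] unfolding bounded_iff by (metis abs_le_D1 rangeI real_norm_def)
      ultimately have "\<forall>i'\<in>set (i # l). \<forall>x. h i' x \<le> max a b" by (auto simp: le_max_iff_disj)
      then show ?case by blast
    qed simp
    then obtain b where b: "\<And>i x. i \<in> set l \<Longrightarrow> h i x \<le> b" by blast
    have "norm (sup_h l x) \<le> max 0 b" for x
      using least[of l x "max 0 b"] b nonneg[of l x] by (simp add: le_max_iff_disj)
    then show ?thesis by (auto intro!: boundedI)
  qed
  have bound_integrable: "integrable \<mu> \<psi>"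
    if \<mu>: "borel_probability_measure \<mu>"
      and \<psi>: "continuous_on UNIV \<psi>" "bounded (range \<psi>)"
    for \<mu> :: "'x measure" and \<psi> :: "'x \<Rightarrow> real"
  proof -
    interpret prob_space \<mu> using \<mu> by (simp add: borel_probability_measure_def)
    have "sets \<mu> = sets borel" using \<mu> by (simp add: borel_probability_measure_def)
    then have "\<psi> \<in> borel_measurable \<mu>"
      using borel_measurable_continuous_onI[OF \<psi>(1)] measurable_cong_sets by blast
    moreover obtain b where "\<And>x. norm (\<psi> x) \<le> b" using \<psi>(2) unfolding bounded_iff by auto
    ultimately show ?thesis by (auto intro!: integrable_const_bound[where B = b])
  qed
  show ?thesis
  proof
    show "continuous_on UNIV (sup_h (from_nat i))" for i by (rule cont)
    show "bounded (range (sup_h (from_nat i)))" for i by (rule bdd)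
  next
    fix \<nu>s :: "nat \<Rightarrow> 'x measure" and \<nu> :: "'x measure"
    assume \<nu>s: "\<And>n. borel_probability_measure (\<nu>s n)" and \<nu>: "borel_probability_measure \<nu>"
      and "\<And>i. (\<lambda>n. integral\<^sup>L (\<nu>s n) (sup_h (from_nat i))) \<longlonglongrightarrow> integral\<^sup>L \<nu> (sup_h (from_nat i))"
    note lim_nat = this(3)
    \<comment> \<open>Finite lists of indices are countable, and \<open>from_nat\<close> reaches
      each of them.\<close>
    have lim: "(\<lambda>n. integral\<^sup>L (\<nu>s n) (sup_h l)) \<longlonglongrightarrow> integral\<^sup>L \<nu> (sup_h l)" for l
      using lim_nat[of "to_nat l"] by simp
    have lower: "eventually (\<lambda>n. a < integral\<^sup>L (\<nu>s n) \<psi>) sequentially"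
      if \<psi>: "continuous_on UNIV \<psi>" "bounded (range \<psi>)" "\<And>x. 0 \<le> \<psi> x" and a: "a < integral\<^sup>L \<nu> \<psi>"
      for a and \<psi> :: "'x \<Rightarrow> real"
    proof -
      \<comment> \<open>The maximum over those of the first \<open>j\<close> approximants that lie
        below \<open>\<psi>\<close>; it increases with \<open>j\<close> and converges to
        \<open>\<psi>\<close> pointwise.\<close>
      define g where "g j = sup_h (filter (\<lambda>i. \<forall>x. h i x \<le> \<psi> x) [0..<j])" for j :: nat
      have g_le: "g j x \<le> \<psi> x" for j x
        unfolding g_def by (rule least) (auto simp: \<psi>)
      have g_lim: "(\<lambda>j. g j x) \<longlonglongrightarrow> \<psi> x" for x
      proof (rule order_tendstoI)
        fix c assume "c < \<psi> x"
        then obtain i where i: "\<forall>x. h i x \<le> \<psi> x" "c < h i x" using h_approx \<psi> by blast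
        then have "h i x \<le> g j x" if "i < j" for j
          unfolding g_def using that by (intro upper) auto
        then show "eventually (\<lambda>j. c < g j x) sequentially"
          using i(2) unfolding eventually_sequentially by (meson less_le_trans lessI Suc_le_eq)
      next
        fix c assume "\<psi> x < c"
        then show "eventually (\<lambda>j. g j x < c) sequentially"
          using g_le le_less_trans by (intro always_eventually) blast
      qed
      have "(\<lambda>j. integral\<^sup>L \<nu> (g j)) \<longlonglongrightarrow> integral\<^sup>L \<nu> \<psi>"
      proof (rule integral_dominated_convergence[where w = \<psi>])
        show "integrable \<nu> \<psi>" by (rule bound_integrable) (fact \<nu> \<psi>)+
        then show "\<psi> \<in> borel_measurable \<nu>" by simp
        show "g j \<in> borel_measurable \<nu>" for j
          using bound_integrable[OF \<nu> cont bdd] unfolding g_def by simp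
        show "AE x in \<nu>. norm (g j x) \<le> \<psi> x" for j
          using g_le nonneg unfolding g_def by simp
      qed (simp add: g_lim)
      from order_tendstoD(1)[OF this a] obtain j where j: "a < integral\<^sup>L \<nu> (g j)"
        unfolding eventually_sequentially by blast
      have "eventually (\<lambda>n. a < integral\<^sup>L (\<nu>s n) (g j)) sequentially"
        using order_tendstoD(1)[OF lim] j unfolding g_def by blast
      moreover have "integral\<^sup>L (\<nu>s n) (g j) \<le> integral\<^sup>L (\<nu>s n) \<psi>" for n
        using bound_integrable[OF \<nu>s cont bdd] bound_integrable[OF \<nu>s \<psi>(1,2)] g_le
        unfolding g_def by (intro integral_mono)
      ultimately show ?thesis by (auto elim!: eventually_mono intro: less_le_trans)
    qed
    show "weakly_converges \<nu>s \<nu>"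
      unfolding weakly_converges_def
    proof (intro allI impI)
      fix \<psi> :: "'x \<Rightarrow> real"
      assume \<psi>: "continuous_on UNIV \<psi> \<and> bounded (range \<psi>)"
      then obtain b where b: "\<And>x. \<bar>\<psi> x\<bar> \<le> b" unfolding bounded_iff by auto
      have "continuous_on UNIV (\<lambda>x. b + \<psi> x)" "continuous_on UNIV (\<lambda>x. b - \<psi> x)"
        using \<psi> by (auto intro!: continuous_intros)
      moreover have "\<bar>b + \<psi> x\<bar> \<le> 2 * b" "\<bar>b - \<psi> x\<bar> \<le> 2 * b" "0 \<le> b + \<psi> x" "0 \<le> b - \<psi> x" for x
        using b[of x] by auto
      then have "bounded (range (\<lambda>x. b + \<psi> x))" "bounded (range (\<lambda>x. b - \<psi> x))"
        "\<And>x. 0 \<le> b + \<psi> x" "\<And>x. 0 \<le> b - \<psi> x"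
        by (auto intro!: boundedI[where B = "2 * b"])
      ultimately have ev: "a < integral\<^sup>L \<nu> (\<lambda>x. b + \<psi> x) \<Longrightarrow>
          eventually (\<lambda>n. a < integral\<^sup>L (\<nu>s n) (\<lambda>x. b + \<psi> x)) sequentially"
        "a < integral\<^sup>L \<nu> (\<lambda>x. b - \<psi> x) \<Longrightarrow>
          eventually (\<lambda>n. a < integral\<^sup>L (\<nu>s n) (\<lambda>x. b - \<psi> x)) sequentially" for a
        using lower by blast+
      have shift: "integral\<^sup>L \<mu> (\<lambda>x. b + \<psi> x) = b + integral\<^sup>L \<mu> \<psi>"
        "integral\<^sup>L \<mu> (\<lambda>x. b - \<psi> x) = b - integral\<^sup>L \<mu> \<psi>"
        if "borel_probability_measure \<mu>" for \<mu>
      proof -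
        interpret prob_space \<mu> using that by (simp add: borel_probability_measure_def)
        have "integrable \<mu> \<psi>" using bound_integrable[OF that] \<psi> by blast
        then show "integral\<^sup>L \<mu> (\<lambda>x. b + \<psi> x) = b + integral\<^sup>L \<mu> \<psi>"
          "integral\<^sup>L \<mu> (\<lambda>x. b - \<psi> x) = b - integral\<^sup>L \<mu> \<psi>"
          by (simp_all add: prob_space)
      qed
      show "(\<lambda>n. integral\<^sup>L (\<nu>s n) \<psi>) \<longlonglongrightarrow> integral\<^sup>L \<nu> \<psi>"
      proof (rule order_tendstoI)
        fix a assume "a < integral\<^sup>L \<nu> \<psi>"
        then show "eventually (\<lambda>n. a < integral\<^sup>L (\<nu>s n) \<psi>) sequentially"
          using ev(1)[of "b + a"] by (simp add: shift \<nu>s \<nu>)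
      next
        fix a assume "integral\<^sup>L \<nu> \<psi> < a"
        then show "eventually (\<lambda>n. integral\<^sup>L (\<nu>s n) \<psi> < a) sequentially"
          using ev(2)[of "b - a"] by (simp add: shift \<nu>s \<nu>)
      qed
    qed
  qed
qed

subsection \<open>Joint measurability\<close>

text \<open>The groups need not be second countable, so joint continuity does not by itself give
  measurability for the product sigma-algebra; approximating the second argument by points of a
  countable dense set does.\<close>

lemma separately_continuous_measurable:
  fixes f :: "'g \<Rightarrow> 'x::metric_space \<Rightarrow> 'y::metric_space"
  assumes sep: "separable_space (euclidean :: 'x topology)"
    and meas: "\<And>x. (\<lambda>u. f u x) \<in> borel_measurable M"
    and cont: "\<And>u. u \<in> space M \<Longrightarrow> continuous_on UNIV (f u)"
  shows "(\<lambda>(u, x). f u x) \<in> borel_measurable (M \<Otimes>\<^sub>M borel)"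
proof -
  obtain d :: "nat \<Rightarrow> 'x" where d: "\<And>x e. e > 0 \<Longrightarrow> \<exists>i. dist x (d i) < e"
    using separable_euclidean_dense_sequence[OF sep] by blast
  \<comment> \<open>The least admissible index depends measurably on \<open>x\<close>, so each
    approximation is a countable gluing of the functions \<open>f u (d i)\<close>, which are
    measurable in \<open>u\<close>.\<close>
  define near where "near k x = (LEAST i. dist x (d i) < inverse (Suc k))" for k x
  have near: "dist x (d (near k x)) < inverse (Suc k)" for k x
    unfolding near_def using d[of "inverse (Suc k)" x] by (auto intro: LeastI_ex)
  have near_meas[measurable]: "near k \<in> borel \<rightarrow>\<^sub>M count_space UNIV" for k
  proof -
    have "(\<lambda>x. dist x (d i)) \<in> borel_measurable borel" for i
      by (intro borel_measurable_continuous_onI continuous_intros)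
    then show ?thesis unfolding near_def by measurable
  qed
  show ?thesis
  proof (rule borel_measurable_LIMSEQ_metric)
    fix k
    have f_meas: "(\<lambda>p. f (fst p) (d i)) \<in> borel_measurable (M \<Otimes>\<^sub>M borel)" for i
      by (rule measurable_compose[OF measurable_fst meas])
    have "(\<lambda>p. near k (snd p)) \<in> M \<Otimes>\<^sub>M borel \<rightarrow>\<^sub>M count_space UNIV" by measurable
    from measurable_compose_countable[OF f_meas this]
    show "(\<lambda>p. f (fst p) (d (near k (snd p)))) \<in> borel_measurable (M \<Otimes>\<^sub>M borel)" .
  next
    fix p :: "'g \<times> 'x" assume "p \<in> space (M \<Otimes>\<^sub>M borel)"
    then obtain u x where p: "p = (u, x)" "u \<in> space M" by (auto simp: space_pair_measure)
    have "(\<lambda>k. dist (d (near k x)) x) \<longlonglongrightarrow> 0"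
    proof (rule tendsto_sandwich[OF _ _ tendsto_const LIMSEQ_inverse_real_of_nat])
      show "\<forall>\<^sub>F k in sequentially. dist (d (near k x)) x \<le> inverse (real (Suc k))"
        using near[of x] by (simp add: dist_commute less_imp_le)
    qed simp
    then have "(\<lambda>k. d (near k x)) \<longlonglongrightarrow> x" by (rule tendsto_dist_iff[THEN iffD2])
    then show "(\<lambda>k. f (fst p) (d (near k (snd p)))) \<longlonglongrightarrow> (case p of (u, x) \<Rightarrow> f u x)"
      using continuous_on_tendsto_compose[OF cont[OF p(2)], of "\<lambda>k. d (near k x)" x] p(1) by simp
  qed
qed

subsection \<open>Averages over a single group\<close>

text \<open>The measure-theoretic side of a compact group action: invariance is stated for left
  translations of \<open>m\<close>, and joint measurability of the action serves Fubini's
  theorem.\<close>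

locale averaged_action = group G for G :: "('g, 'b) monoid_scheme" (structure) +
  fixes m :: "'g measure" and act :: "'g \<Rightarrow> 'x::topological_space \<Rightarrow> 'x"
  assumes prob_m: "prob_space m"
    and space_m: "space m = carrier G"
    and inv_measurable: "(\<lambda>u. inv u) \<in> m \<rightarrow>\<^sub>M m"
    and mult_measurable: "v \<in> carrier G \<Longrightarrow> (\<lambda>u. v \<otimes> u) \<in> m \<rightarrow>\<^sub>M m"
    and mult_invariant: "v \<in> carrier G \<Longrightarrow> distr m m (\<lambda>u. v \<otimes> u) = m"
    and act_mult: "u \<in> carrier G \<Longrightarrow> v \<in> carrier G \<Longrightarrow> act (u \<otimes> v) x = act u (act v x)"
    and act_one: "act \<one> x = x"
    and act_measurable: "(\<lambda>(u, x). act u x) \<in> m \<Otimes>\<^sub>M borel \<rightarrow>\<^sub>M borel"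
begin

sublocale m: prob_space m by (rule prob_m)

definition average :: "('x \<Rightarrow> real) \<Rightarrow> 'x \<Rightarrow> real" where
  "average f x = (\<integral>u. f (act u x) \<partial>m)"

lemma measurable_act [measurable (raw)]:
  assumes "g \<in> N \<rightarrow>\<^sub>M m" "h \<in> N \<rightarrow>\<^sub>M borel"
  shows "(\<lambda>z. act (g z) (h z)) \<in> N \<rightarrow>\<^sub>M borel"
  using measurable_compose[OF measurable_Pair[OF assms] act_measurable] by simp

lemma act_single_measurable:
  assumes "u \<in> carrier G"
  shows "act u \<in> borel \<rightarrow>\<^sub>M borel"
  using measurable_act[of "\<lambda>_. u" borel "\<lambda>x. x"] assms by (simp add: space_m)

lemma act_inv: "u \<in> carrier G \<Longrightarrow> act (inv u) (act u x) = x"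
  by (metis act_mult act_one inv_closed l_inv)

lemma act_vimage_eq_image: "u \<in> carrier G \<Longrightarrow> act u -` Y = act (inv u) ` Y"
  by (auto simp: act_inv image_iff) (metis act_inv inv_closed inv_inv)+

lemma average_measurable [measurable]:
  assumes [measurable]: "f \<in> borel_measurable borel"
  shows "average f \<in> borel_measurable borel"
  unfolding average_def by measurable

lemma integrable_act:
  fixes f :: "'x \<Rightarrow> real"
  assumes [measurable]: "f \<in> borel_measurable borel" and "\<And>x. \<bar>f x\<bar> \<le> b"
  shows "integrable m (\<lambda>u. f (act u x))"
  using assms(2) by (intro m.integrable_const_bound[where B = b]) auto

lemma average_affine:
  assumes "f \<in> borel_measurable borel" and "\<And>x. \<bar>f x\<bar> \<le> b"
  shows "average (\<lambda>x. a * f x + c) x = a * average f x + c"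
  using integrable_act[OF assms] unfolding average_def by (simp add: m.prob_space)

lemma integral_shift:
  fixes f :: "'g \<Rightarrow> real"
  assumes [measurable]: "f \<in> borel_measurable m" and v: "v \<in> carrier G"
  shows "(\<integral>u. f (v \<otimes> u) \<partial>m) = (\<integral>u. f u \<partial>m)"
proof -
  have "(\<integral>u. f u \<partial>distr m m (\<lambda>u. v \<otimes> u)) = (\<integral>u. f (v \<otimes> u) \<partial>m)"
    by (rule integral_distr) (use mult_measurable[OF v] in simp_all)
  then show ?thesis by (simp add: mult_invariant[OF v])
qed

text \<open>Since \<open>u\<inverse> v = (v\<inverse> u)\<inverse>\<close>, passing from
  \<open>x\<close> to \<open>v x\<close> amounts to a left translation of the integration variable,
  under which \<open>m\<close> is invariant.\<close>

lemma average_inv_shift: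
  fixes f :: "'x \<Rightarrow> real"
  assumes [measurable]: "f \<in> borel_measurable borel" and v: "v \<in> carrier G"
  shows "(\<integral>u. f (act (inv u) (act v x)) \<partial>m) = (\<integral>u. f (act (inv u) x) \<partial>m)"
proof -
  note [measurable] = inv_measurable
  have "(\<integral>u. f (act (inv u) (act v x)) \<partial>m) = (\<integral>u. f (act (inv (inv v \<otimes> u)) x) \<partial>m)"
    using v by (intro Bochner_Integration.integral_cong) (simp_all add: space_m inv_mult_group act_mult)
  also have "\<dots> = (\<integral>u. f (act (inv u) x) \<partial>m)"
    by (rule integral_shift) (use v in simp_all)
  finally show ?thesis .
qed

text \<open>Integrating \<open>f (u\<inverse> v x)\<close> in both orders: the left Haar measure averages \<open>f\<close> over
  the orbit in the same way as its image under inversion.  This replaces the right invariance of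
  the Haar measure, i.e. the unimodularity of compact groups.\<close>

lemma average_eq_average_inv:
  assumes [measurable]: "f \<in> borel_measurable borel" and b: "\<And>x. \<bar>f x\<bar> \<le> b"
  shows "average f x = (\<integral>u. f (act (inv u) x) \<partial>m)"
proof -
  note [measurable] = inv_measurable
  interpret mm: pair_prob_space m m ..
  have "integrable (m \<Otimes>\<^sub>M m) (\<lambda>(u, v). f (act (inv u) (act v x)))"
    using b by (intro mm.integrable_const_bound[where B = b]) auto
  then have "(\<integral>v. (\<integral>u. f (act (inv u) (act v x)) \<partial>m) \<partial>m) = (\<integral>u. (\<integral>v. f (act (inv u) (act v x)) \<partial>m) \<partial>m)"
    by (rule mm.Fubini_integral)
  also have "\<dots> = (\<integral>u. average f x \<partial>m)"
  proof (rule Bochner_Integration.integral_cong)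
    fix u assume "u \<in> space m"
    then have u: "inv u \<in> carrier G" by (simp add: space_m)
    have "(\<integral>v. f (act (inv u) (act v x)) \<partial>m) = (\<integral>v. f (act (inv u \<otimes> v) x) \<partial>m)"
      using u by (intro Bochner_Integration.integral_cong) (simp_all add: space_m act_mult)
    also have "\<dots> = average f x"
      unfolding average_def by (rule integral_shift[where f = "\<lambda>v. f (act v x)"]) (use u in simp_all)
    finally show "(\<integral>v. f (act (inv u) (act v x)) \<partial>m) = average f x" .
  qed simp
  also have "(\<integral>v. (\<integral>u. f (act (inv u) (act v x)) \<partial>m) \<partial>m) = (\<integral>v. (\<integral>u. f (act (inv u) x) \<partial>m) \<partial>m)"
    by (intro Bochner_Integration.integral_cong refl average_inv_shift) (simp_all add: space_m)
  finally show ?thesis by (simp add: m.prob_space)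
qed

text \<open>Moving \<open>x\<close> to \<open>v x\<close> in the average is a right translation of
  \<open>u\<close>. Once the average is written with inverses, the same move becomes a left
  translation.\<close>

lemma average_invariant:
  assumes "f \<in> borel_measurable borel" "\<And>x. \<bar>f x\<bar> \<le> b" "v \<in> carrier G"
  shows "average f (act v x) = average f x"
  by (simp add: average_eq_average_inv[OF assms(1,2)] average_inv_shift assms)

text \<open>The characteristic identity of a conditional expectation given the invariant sets.
  Fubini brings the integral over \<open>\<nu>\<close> inside; for fixed \<open>u\<close>,
  invariance of \<open>A\<close> and of \<open>\<nu>\<close> then removes \<open>u\<close> from the
  integrand.\<close>

lemma integral_average_invariant_set:
  assumes f [measurable]: "f \<in> borel_measurable borel" and b: "\<And>x. \<bar>f x\<bar> \<le> b"
    and \<nu>: "borel_probability_measure \<nu>"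
    and invar: "\<And>u. u \<in> carrier G \<Longrightarrow> distr \<nu> borel (act u) = \<nu>"
    and A [measurable]: "A \<in> sets borel" and A_invar: "\<And>u x. u \<in> carrier G \<Longrightarrow> act u x \<in> A \<longleftrightarrow> x \<in> A"
  shows "(LINT x:A|\<nu>. average f x) = (LINT x:A|\<nu>. f x)"
proof -
  have sets [measurable_cong]: "sets \<nu> = sets borel" and "prob_space \<nu>"
    using \<nu> by (simp_all add: borel_probability_measure_def)
  interpret \<nu>: prob_space \<nu> by fact
  interpret m\<nu>: pair_prob_space m \<nu> ..
  let ?g = "\<lambda>u x. indicator A x * f (act u x)"
  have "\<bar>?g u x\<bar> \<le> b" for u x using b[of "act u x"] by (auto split: split_indicator)
  then have "integrable (m \<Otimes>\<^sub>M \<nu>) (\<lambda>(u, x). ?g u x)"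
    by (intro m\<nu>.integrable_const_bound[where B = b]) auto
  then have "(\<integral>x. (\<integral>u. ?g u x \<partial>m) \<partial>\<nu>) = (\<integral>u. (\<integral>x. ?g u x \<partial>\<nu>) \<partial>m)"
    by (rule m\<nu>.Fubini_integral)
  also have "\<dots> = (\<integral>u. (\<integral>x. indicator A x * f x \<partial>\<nu>) \<partial>m)"
  proof (rule Bochner_Integration.integral_cong)
    fix u assume "u \<in> space m"
    then have u: "u \<in> carrier G" by (simp add: space_m)
    \<comment> \<open>Invariance of \<open>A\<close> lets the indicator be evaluated at
      \<open>act u x\<close>, so that the whole integrand is a function of
      \<open>act u x\<close>.\<close>
    have "(\<integral>x. ?g u x \<partial>\<nu>) = (\<integral>x. indicator A (act u x) * f (act u x) \<partial>\<nu>)"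
      using A_invar[OF u] by (intro Bochner_Integration.integral_cong) (auto split: split_indicator)
    also have "\<dots> = (\<integral>x. indicator A x * f x \<partial>distr \<nu> borel (act u))"
      using act_single_measurable[OF u]
      by (intro integral_distr[symmetric]) (simp_all cong: measurable_cong_sets add: sets)
    finally show "(\<integral>x. ?g u x \<partial>\<nu>) = (\<integral>x. indicator A x * f x \<partial>\<nu>)" by (simp add: invar[OF u])
  qed simp
  finally show ?thesis
    by (simp add: set_lebesgue_integral_def average_def m.prob_space)
qed

end

subsection \<open>Convergence of the averages\<close>

text \<open>Ergodicity enters as a zero-one law for sets that are invariant exactly, not merely up
  to null sets; the set where positive averages recur infinitely often is of this kind.\<close>

locale averaged_chain =
  fixes K :: "nat \<Rightarrow> ('g, 'b) monoid_scheme" and m :: "nat \<Rightarrow> 'g measure"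
    and act :: "'g \<Rightarrow> 'x::topological_space \<Rightarrow> 'x" and \<nu> :: "'x measure"
  assumes averaged: "averaged_action (K n) (m n) act"
    and carrier_mono: "k \<le> n \<Longrightarrow> carrier (K k) \<subseteq> carrier (K n)"
    and borel_prob: "borel_probability_measure \<nu>"
    and distr_act: "u \<in> carrier (K n) \<Longrightarrow> distr \<nu> borel (act u) = \<nu>"
    and zero_one: "\<lbrakk>Y \<in> sets borel; \<And>n u x. u \<in> carrier (K n) \<Longrightarrow> act u x \<in> Y \<longleftrightarrow> x \<in> Y\<rbrakk> \<Longrightarrow>
      measure \<nu> Y = 0 \<or> measure \<nu> Y = 1"
begin

sublocale step: averaged_action "K n" "m n" act for n by (rule averaged)

sublocale \<nu>: prob_space \<nu>
  using borel_prob by (simp add: borel_probability_measure_def)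

lemma sets_\<nu> [measurable_cong]: "sets \<nu> = sets borel"
  using borel_prob by (simp add: borel_probability_measure_def)

lemma space_\<nu> [simp]: "space \<nu> = UNIV"
  using sets_eq_imp_space_eq[OF sets_\<nu>] by simp

lemma measure_UNIV [simp]: "measure \<nu> UNIV = 1"
  using \<nu>.prob_space by simp

lemma integrable_bounded:
  fixes f :: "'x \<Rightarrow> real"
  assumes [measurable]: "f \<in> borel_measurable borel" and "\<And>x. \<bar>f x\<bar> \<le> b"
  shows "integrable \<nu> f"
  using assms(2) by (intro \<nu>.integrable_const_bound[where B = b]) auto

lemma average_invariant_later:
  assumes "f \<in> borel_measurable borel" "\<And>x. \<bar>f x\<bar> \<le> b" "u \<in> carrier (K k)" "k \<le> n"
  shows "step.average n f (act u x) = step.average n f x"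
  using assms carrier_mono[of k n] by (intro step.average_invariant) auto

text \<open>Doob's decomposition for a reverse martingale: the set where some average is positive is
  split according to the \<^emph>\<open>last\<close> index with a positive average, because a condition on
  the averages with indices at least \<open>n\<close> is invariant under the \<open>n\<close>-th group.\<close>

lemma maximal_inequality:
  assumes f [measurable]: "f \<in> borel_measurable borel" and b: "\<And>x. \<bar>f x\<bar> \<le> b"
  shows "0 \<le> (LINT x:{x. \<exists>n\<le>N. 0 < step.average n f x}|\<nu>. f x)"
proof -
  define B where "B n = {x. 0 < step.average n f x \<and> (\<forall>k\<in>{n<..N}. step.average k f x \<le> 0)}" for n
  have B_sets [measurable]: "B n \<in> sets borel" for n unfolding B_def by measurable
  have "(\<exists>n\<le>N. 0 < step.average n f x) \<longleftrightarrow> (\<exists>n\<le>N. x \<in> B n)" for x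
  proof
    assume ex: "\<exists>n\<le>N. 0 < step.average n f x"
    define l where "l = (GREATEST n. n \<le> N \<and> 0 < step.average n f x)"
    have "l \<le> N \<and> 0 < step.average l f x"
      unfolding l_def using ex by (rule GreatestI_ex_nat[where b = N]) simp
    moreover have "k \<le> l" if "k \<le> N \<and> 0 < step.average k f x" for k
      unfolding l_def using that by (rule Greatest_le_nat[where b = N]) simp
    ultimately show "\<exists>n\<le>N. x \<in> B n"
      unfolding B_def by (intro exI[of _ l]) (auto simp: not_less[symmetric])
  qed (auto simp: B_def)
  then have union: "{x. \<exists>n\<le>N. 0 < step.average n f x} = (\<Union>n\<in>{..N}. B n)" by auto
  \<comment> \<open>Of two pieces, the one with the smaller index demands a nonpositive average at
    the larger index, where the other demands a positive one.\<close>
  have disj: "disjoint_family_on B {..N}"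
    unfolding disjoint_family_on_def
  proof (intro ballI impI)
    fix i j assume "i \<in> {..N}" "j \<in> {..N}" "i \<noteq> j"
    then have "j \<in> {i<..N} \<or> i \<in> {j<..N}" by auto
    then show "B i \<inter> B j = {}" unfolding B_def by force
  qed
  have "set_integrable \<nu> (B n) f" for n
    using integrable_bounded[OF assms] unfolding set_integrable_def
    by (intro integrable_mult_indicator) simp_all
  then have "(LINT x:(\<Union>n\<in>{..N}. B n)|\<nu>. f x) = (\<Sum>n\<in>{..N}. LINT x:B n|\<nu>. f x)"
    using disj by (intro set_integral_finite_Union) simp_all
  \<comment> \<open>Over the invariant piece \<open>B n\<close> the function integrates like its
    \<open>n\<close>-th average, which is positive there.\<close>
  also have "\<dots> = (\<Sum>n\<in>{..N}. LINT x:B n|\<nu>. step.average n f x)"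
  proof (rule sum.cong)
    fix n
    have "act u x \<in> B n \<longleftrightarrow> x \<in> B n" if "u \<in> carrier (K n)" for u x
      using average_invariant_later[OF assms that] unfolding B_def by auto
    then show "(LINT x:B n|\<nu>. f x) = (LINT x:B n|\<nu>. step.average n f x)"
      using step.integral_average_invariant_set[OF assms borel_prob distr_act B_sets] by simp
  qed simp
  also have "\<dots> \<ge> 0"
    unfolding set_lebesgue_integral_def
    by (intro sum_nonneg integral_nonneg_AE AE_I2) (auto simp: B_def split: split_indicator)
  finally show ?thesis by (simp add: union)
qed

lemma AE_eventually_average_nonpos:
  assumes f [measurable]: "f \<in> borel_measurable borel" and b: "\<And>x. \<bar>f x\<bar> \<le> b"
    and neg: "(\<integral>x. f x \<partial>\<nu>) < 0"
  shows "AE x in \<nu>. eventually (\<lambda>n. step.average n f x \<le> 0) sequentially"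
proof -
  define Y where "Y = {x. \<forall>k. \<exists>n\<ge>k. 0 < step.average n f x}"
  have Y_sets [measurable]: "Y \<in> sets borel" unfolding Y_def by measurable
  have "act u x \<in> Y \<longleftrightarrow> x \<in> Y" if u: "u \<in> carrier (K k)" for u x k
  proof -
    \<comment> \<open>Averages with index at least \<open>k\<close> are invariant under
      \<open>K k\<close>, and dropping finitely many indices does not affect whether positive
      averages recur. Hence \<open>Y\<close> is invariant under every group of the chain.\<close>
    have tail: "x \<in> Y \<longleftrightarrow> (\<forall>j\<ge>k. \<exists>n\<ge>j. 0 < step.average n f x)" for x
    proof
      assume late: "\<forall>j\<ge>k. \<exists>n\<ge>j. 0 < step.average n f x"
      show "x \<in> Y"
        unfolding Y_def
      proof (intro CollectI allI)
        fix j
        show "\<exists>n\<ge>j. 0 < step.average n f x" using late[rule_format, of "max j k"] by auto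
      qed
    qed (simp add: Y_def)
    have "(\<exists>n\<ge>j. 0 < step.average n f (act u x)) \<longleftrightarrow> (\<exists>n\<ge>j. 0 < step.average n f x)" if "k \<le> j" for j
      using average_invariant_later[OF f b u] that by (intro ex_cong1 conj_cong refl) simp
    then show ?thesis unfolding tail by simp
  qed
  then have "measure \<nu> Y = 0 \<or> measure \<nu> Y = 1" by (rule zero_one[OF Y_sets])
  moreover have "measure \<nu> Y \<noteq> 1"
  proof
    assume "measure \<nu> Y = 1"
    then have AE_Y: "AE x in \<nu>. x \<in> Y" by (intro \<nu>.AE_prob_1)
    define A where "A N = {x. \<exists>n\<le>N. 0 < step.average n f x}" for N
    have A_sets [measurable]: "A N \<in> sets borel" for N unfolding A_def by measurable
    \<comment> \<open>The sets \<open>A N\<close> increase to a set containing \<open>Y\<close>,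
      hence to almost the whole space. The maximal inequality thus passes to the limit and
      contradicts \<open>neg\<close>.\<close>
    have "(\<lambda>N. LINT x:A N|\<nu>. f x) \<longlonglongrightarrow> (\<integral>x. f x \<partial>\<nu>)"
      unfolding set_lebesgue_integral_def
    proof (rule integral_dominated_convergence[where w = "\<lambda>_. b"])
      show "AE x in \<nu>. (\<lambda>N. indicator (A N) x *\<^sub>R f x) \<longlonglongrightarrow> f x"
        using AE_Y
      proof eventually_elim
        fix x assume "x \<in> Y"
        then obtain n where "0 < step.average n f x" unfolding Y_def by blast
        then have "x \<in> A N" if "n \<le> N" for N
          using that unfolding A_def by blast
        then have "indicator (A N) x *\<^sub>R f x = f x" if "n \<le> N" for N
          using that by simp
        then show "(\<lambda>N. indicator (A N) x *\<^sub>R f x) \<longlonglongrightarrow> f x"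
          by (intro tendsto_eventually) (auto simp: eventually_sequentially)
      qed
      \<comment> \<open>Here \<open>undefined\<close> merely names some point of the space; the
        bound at any point forces \<open>b\<close> to be nonnegative.\<close>
      have "0 \<le> b" using b[of undefined] by linarith
      then show "AE x in \<nu>. norm (indicator (A N) x *\<^sub>R f x) \<le> b" for N
        using b by (auto split: split_indicator)
    qed simp_all
    then have "0 \<le> (\<integral>x. f x \<partial>\<nu>)"
      by (rule LIMSEQ_le_const) (use maximal_inequality[OF f b] in \<open>auto simp: A_def\<close>)
    with neg show False by simp
  qed
  ultimately have "emeasure \<nu> Y = 0" by (simp add: \<nu>.emeasure_eq_measure)
  then have "AE x in \<nu>. x \<notin> Y" by (intro AE_not_in) (simp add: null_setsI sets_\<nu>)
  then show ?thesis
    by eventually_elim (auto simp: Y_def eventually_sequentially not_less)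
qed

end

text \<open>Only countably many tolerances remain, so almost sure estimates can be intersected over
  \<open>j\<close>, and sets of convergence become Borel by countable operations.\<close>

lemma LIMSEQ_iff_inverse_Suc:
  fixes a :: "nat \<Rightarrow> real"
  shows "a \<longlonglongrightarrow> l \<longleftrightarrow> (\<forall>j. \<forall>\<^sub>F n in sequentially. \<bar>a n - l\<bar> \<le> inverse (real (Suc j)))"
proof
  assume "a \<longlonglongrightarrow> l"
  then have "\<forall>\<^sub>F n in sequentially. \<bar>a n - l\<bar> < inverse (real (Suc j))" for j
    unfolding tendsto_iff dist_real_def by simp
  then show "\<forall>j. \<forall>\<^sub>F n in sequentially. \<bar>a n - l\<bar> \<le> inverse (real (Suc j))"
    by (blast intro: eventually_mono less_imp_le)
next
  assume close: "\<forall>j. \<forall>\<^sub>F n in sequentially. \<bar>a n - l\<bar> \<le> inverse (real (Suc j))"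
  show "a \<longlonglongrightarrow> l"
    unfolding tendsto_iff dist_real_def
  proof (intro allI impI)
    fix e :: real assume "0 < e"
    then obtain j where "inverse (real (Suc j)) < e" using reals_Archimedean by blast
    with close[rule_format, of j] show "\<forall>\<^sub>F n in sequentially. \<bar>a n - l\<bar> < e"
      by (auto elim!: eventually_mono)
  qed
qed

lemma (in averaged_chain) AE_average_tendsto:
  assumes f [measurable]: "f \<in> borel_measurable borel" and b: "\<And>x. \<bar>f x\<bar> \<le> b"
  shows "AE x in \<nu>. (\<lambda>n. step.average n f x) \<longlonglongrightarrow> (\<integral>x. f x \<partial>\<nu>)"
proof -
  let ?I = "\<integral>x. f x \<partial>\<nu>"
  have one_sided: "AE x in \<nu>. \<forall>\<^sub>F n in sequentially. a * (step.average n f x - ?I) \<le> e"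
    if e: "0 < e" for a e
  proof -
    \<comment> \<open>This is \<open>a * (f x - ?I) - e\<close>, of integral \<open>- e\<close>;
      that its average is nonpositive is exactly the one-sided estimate.\<close>
    let ?g = "\<lambda>x. a * f x + (- a * ?I - e)"
    have "\<bar>?g x\<bar> \<le> \<bar>a\<bar> * b + \<bar>- a * ?I - e\<bar>" for x
      using mult_left_mono[OF b[of x], of "\<bar>a\<bar>"] abs_triangle_ineq[of "a * f x" "- a * ?I - e"]
      by (simp add: abs_mult)
    moreover have "(\<integral>x. ?g x \<partial>\<nu>) < 0"
      using integrable_bounded[OF f b] e by simp
    ultimately have "AE x in \<nu>. \<forall>\<^sub>F n in sequentially. step.average n ?g x \<le> 0"
      by (intro AE_eventually_average_nonpos) simp_all
    then show ?thesis unfolding step.average_affine[OF f b] by (simp add: algebra_simps)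
  qed
  \<comment> \<open>The factors 1 and -1 give the upper and the lower estimate.\<close>
  have "AE x in \<nu>. \<forall>\<^sub>F n in sequentially. \<bar>step.average n f x - ?I\<bar> \<le> e" if e: "0 < e" for e
    using one_sided[OF e, of 1] one_sided[OF e, of "-1"]
    by eventually_elim (auto elim: eventually_elim2)
  then show ?thesis by (simp add: LIMSEQ_iff_inverse_Suc AE_all_countable)
qed

subsection \<open>Haar measures on the chain\<close>

lemma haar_continuous_measurable:
  assumes G: "compact_group G T" and m: "normalized_haar_measure G T m" and f: "continuous_map T T f"
  shows "f \<in> m \<rightarrow>\<^sub>M m"
proof (rule measurable_sigma_sets)
  have top: "topspace T = carrier G" using G by (simp add: compact_group_def)
  have space: "space m = carrier G" and sets: "sets m = sigma_sets (carrier G) {U. openin T U}"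
    using m by (simp_all add: normalized_haar_measure_def)
  show "sets m = sigma_sets (carrier G) {U. openin T U}" by (fact sets)
  show "{U. openin T U} \<subseteq> Pow (carrier G)" using openin_subset top by auto
  show "f \<in> space m \<rightarrow> carrier G" using continuous_map_funspace[OF f] by (simp add: space top)
  fix U assume "U \<in> {U. openin T U}"
  then have "openin T {x \<in> topspace T. f x \<in> U}" using f by (simp add: openin_continuous_map_preimage)
  moreover have "f -` U \<inter> space m = {x \<in> topspace T. f x \<in> U}" by (auto simp: space top)
  ultimately show "f -` U \<inter> space m \<in> sets m" by (simp add: sets sigma_sets.Basic)
qed

lemma haar_borel_measurable:
  assumes G: "compact_group G T" and m: "normalized_haar_measure G T m"
    and f: "continuous_map T euclidean f"
  shows "f \<in> borel_measurable m"
proof (rule borel_measurableI)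
  have top: "topspace T = carrier G" using G by (simp add: compact_group_def)
  have space: "space m = carrier G" and sets: "sets m = sigma_sets (carrier G) {U. openin T U}"
    using m by (simp_all add: normalized_haar_measure_def)
  fix U :: "'c set" assume "open U"
  then have "openin T {x \<in> topspace T. f x \<in> U}" using f by (auto intro!: openin_continuous_map_preimage)
  moreover have "f -` U \<inter> space m = {x \<in> topspace T. f x \<in> U}" by (auto simp: space top)
  ultimately show "f -` U \<inter> space m \<in> sets m" by (simp add: sets sigma_sets.Basic)
qed

text \<open>Continuity of the group operations gives their measurability for the sigma-algebra
  generated by the open sets, and separability of the space gives joint measurability of the
  action.\<close>

lemma averaged_action_haar:
  fixes act :: "'g \<Rightarrow> 'x::metric_space \<Rightarrow> 'x"
  assumes sep: "separable_space (euclidean :: 'x topology)"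
    and G: "compact_group G T" and m: "normalized_haar_measure G T m"
    and act_mult: "\<And>u v x. u \<in> carrier G \<Longrightarrow> v \<in> carrier G \<Longrightarrow> act (u \<otimes>\<^bsub>G\<^esub> v) x = act u (act v x)"
    and act_one: "\<And>x. act \<one>\<^bsub>G\<^esub> x = x"
    and cont: "continuous_map (prod_topology T euclidean) euclidean (\<lambda>(u, x). act u x)"
  shows "averaged_action G m act"
proof -
  interpret group G using G by (simp add: compact_group_def)
  have top: "topspace T = carrier G"
    and cont_mult: "continuous_map (prod_topology T T) T (\<lambda>(u, v). u \<otimes>\<^bsub>G\<^esub> v)"
    and cont_inv: "continuous_map T T (\<lambda>u. inv\<^bsub>G\<^esub> u)"
    using G by (simp_all add: compact_group_def)
  have space: "space m = carrier G" and "prob_space m"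
    and haar: "\<And>u A. u \<in> carrier G \<Longrightarrow> A \<in> sets m \<Longrightarrow> emeasure m (u <#\<^bsub>G\<^esub> A) = emeasure m A"
    using m by (simp_all add: normalized_haar_measure_def)
  have mult_meas: "(\<lambda>u. v \<otimes>\<^bsub>G\<^esub> u) \<in> m \<rightarrow>\<^sub>M m" if v: "v \<in> carrier G" for v
  proof (rule haar_continuous_measurable[OF G m])
    have "continuous_map T (prod_topology T T) (\<lambda>u. (v, u))"
      using v by (intro continuous_map_pairedI) (simp_all add: top)
    from continuous_map_compose[OF this cont_mult]
    show "continuous_map T T (\<lambda>u. v \<otimes>\<^bsub>G\<^esub> u)" by (simp add: o_def)
  qed
  show ?thesis
  proof (intro averaged_action.intro averaged_action_axioms.intro)
    show "group G" ..
    show "prob_space m" "space m = carrier G" by fact+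
    show "(\<lambda>u. inv\<^bsub>G\<^esub> u) \<in> m \<rightarrow>\<^sub>M m" by (rule haar_continuous_measurable[OF G m cont_inv])
  next
    fix v assume v: "v \<in> carrier G"
    show "(\<lambda>u. v \<otimes>\<^bsub>G\<^esub> u) \<in> m \<rightarrow>\<^sub>M m" by (rule mult_meas[OF v])
    show "distr m m (\<lambda>u. v \<otimes>\<^bsub>G\<^esub> u) = m"
    proof (rule measure_eqI)
      fix A assume "A \<in> sets (distr m m (\<lambda>u. v \<otimes>\<^bsub>G\<^esub> u))"
      then have A: "A \<in> sets m" by simp
      then have sub: "A \<subseteq> carrier G" using sets.sets_into_space space by auto
      \<comment> \<open>Haar invariance speaks of cosets, which are images, whereas
        \<open>distr\<close> uses preimages; the preimage under translation by \<open>v\<close> is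
        the coset of the inverse.\<close>
      have "(\<lambda>u. v \<otimes>\<^bsub>G\<^esub> u) -` A \<inter> space m = inv\<^bsub>G\<^esub> v <#\<^bsub>G\<^esub> A"
      proof (intro equalityI subsetI)
        fix u assume u: "u \<in> (\<lambda>u. v \<otimes>\<^bsub>G\<^esub> u) -` A \<inter> space m"
        then have "u = inv\<^bsub>G\<^esub> v \<otimes>\<^bsub>G\<^esub> (v \<otimes>\<^bsub>G\<^esub> u)" using v by (simp add: space m_assoc[symmetric])
        then show "u \<in> inv\<^bsub>G\<^esub> v <#\<^bsub>G\<^esub> A" using u unfolding l_coset_def by auto
      next
        fix u assume "u \<in> inv\<^bsub>G\<^esub> v <#\<^bsub>G\<^esub> A"
        then obtain a where a: "a \<in> A" "u = inv\<^bsub>G\<^esub> v \<otimes>\<^bsub>G\<^esub> a" unfolding l_coset_def by auto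
        then show "u \<in> (\<lambda>u. v \<otimes>\<^bsub>G\<^esub> u) -` A \<inter> space m"
          using v sub by (auto simp: space m_assoc[symmetric] subset_iff)
      qed
      then show "emeasure (distr m m (\<lambda>u. v \<otimes>\<^bsub>G\<^esub> u)) A = emeasure m A"
        using v by (simp add: emeasure_distr[OF mult_meas[OF v] A] haar A)
    qed simp
  next
    show "(\<lambda>(u, x). act u x) \<in> m \<Otimes>\<^sub>M borel \<rightarrow>\<^sub>M borel"
    proof (rule separately_continuous_measurable[OF sep])
      fix x :: 'x
      have "continuous_map T (prod_topology T euclidean) (\<lambda>u. (u, x))"
        by (intro continuous_map_pairedI) simp_all
      from continuous_map_compose[OF this cont]
      show "(\<lambda>u. act u x) \<in> borel_measurable m"
        by (intro haar_borel_measurable[OF G m]) (simp add: o_def)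
    next
      fix u assume "u \<in> space m"
      then have "continuous_map euclidean (prod_topology T euclidean) (\<lambda>x :: 'x. (u, x))"
        by (intro continuous_map_pairedI) (simp_all add: top space)
      from continuous_map_compose[OF this cont]
      show "continuous_on UNIV (act u)" by (simp add: o_def)
    qed
  qed (simp_all add: act_mult act_one)
qed

text \<open>Immediate from finality once the union of the groups is seen to be open in the limit
  topology, hence contained in its underlying set. It restricts the continuous action of the limit
  to each group of the chain.\<close>

lemma continuous_map_inductive_limit_inclusion:
  "continuous_map (T n) (inductive_limit_topology T) (\<lambda>u. u)"
proof -
  have "(\<Union>n. topspace (T n)) \<inter> topspace (T n) = topspace (T n)" for n by blast
  then have "openin (inductive_limit_topology T) (\<Union>n. topspace (T n))"
    unfolding openin_inductive_limit_topology by simp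
  then have "(\<Union>n. topspace (T n)) \<subseteq> topspace (inductive_limit_topology T)" by (rule openin_subset)
  moreover have "{u \<in> topspace (T n). u \<in> U} = U \<inter> topspace (T n)" for U by auto
  ultimately show ?thesis
    unfolding continuous_map_def by (auto simp: openin_inductive_limit_topology)
qed

section \<open>Almost everywhere weak convergence of the orbital measures of the inductive
  limit\<close>

theorem theorem3p2:
  fixes K :: "nat \<Rightarrow> ('g, 'b) monoid_scheme"
    and T :: "nat \<Rightarrow> 'g topology"
    and m :: "nat \<Rightarrow> 'g measure"
    and act :: "'g \<Rightarrow> 'x::metric_space \<Rightarrow> 'x"
    and \<nu> :: "'x measure"
  assumes separable: "separable_space (euclidean :: 'x topology)"
    and chain: "ascending_chain_of_compact_groups K T"
    and haar: "\<And>n. normalized_haar_measure (K n) (T n) (m n)"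
    and action: "continuous_action (inductive_limit_group K) (inductive_limit_topology T) act"
    and prob: "borel_probability_measure \<nu>"
    and invariant: "invariant_measure (inductive_limit_group K) act \<nu>"
    and ergodic: "ergodic_measure (inductive_limit_group K) act \<nu>"
  shows "(\<exists>x. weakly_converges (\<lambda>n. orbital_measure (m n) act x) \<nu>) \<and>
         {x. weakly_converges (\<lambda>n. orbital_measure (m n) act x) \<nu>} \<in> sets \<nu> \<and>
         measure \<nu> {x. weakly_converges (\<lambda>n. orbital_measure (m n) act x) \<nu>} = 1"
proof -
  let ?L = "inductive_limit_group K"
  have compact: "compact_group (K n) (T n)" for n
    using chain unfolding ascending_chain_of_compact_groups_def by blast
  have carrier: "carrier ?L = (\<Union>n. carrier (K n))" by (simp add: inductive_limit_group_def)
  interpret ga: group_action ?L UNIV act using action by (simp add: continuous_action_def)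
  have act_mult: "act (u \<otimes>\<^bsub>K n\<^esub> v) x = act u (act v x)"
    if "u \<in> carrier (K n)" "v \<in> carrier (K n)" for n u v x
    using ga.composition_rule[of x u v] that
    by (auto simp: carrier mult_inductive_limit_group[OF chain that])
  have act_inj: "act u x = act u y \<Longrightarrow> x = y" if "u \<in> carrier (K n)" for n u x y
    using ga.inj_prop[of u] that by (auto simp: carrier inj_on_def)
  have averaged: "averaged_action (K n) (m n) act" for n
  proof (rule averaged_action_haar[OF separable compact haar act_mult])
    have "group (K n)" using compact[of n] by (simp add: compact_group_def)
    then have one: "\<one>\<^bsub>K n\<^esub> \<in> carrier (K n)" "\<one>\<^bsub>K n\<^esub> \<otimes>\<^bsub>K n\<^esub> \<one>\<^bsub>K n\<^esub> = \<one>\<^bsub>K n\<^esub>"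
      by (simp_all add: group.is_monoid monoid.one_closed monoid.l_one)
    \<comment> \<open>The unit of \<open>K n\<close> is idempotent, so it acts by an idempotent map;
      being injective, that map is the identity.\<close>
    show "act \<one>\<^bsub>K n\<^esub> x = x" for x
      using act_inj[OF one(1)] act_mult[OF one(1) one(1)] by (metis one(2))
    have "continuous_map (prod_topology (T n) (euclidean :: 'x topology))
        (prod_topology (inductive_limit_topology T) euclidean) (\<lambda>p. (fst p, snd p))"
      using continuous_map_compose[OF continuous_map_fst continuous_map_inductive_limit_inclusion]
      by (intro continuous_map_pairedI continuous_map_snd) (simp add: o_def)
    moreover have "continuous_map (prod_topology (inductive_limit_topology T) euclidean)
        euclidean (\<lambda>(u, x). act u x)"
      using action by (simp add: continuous_action_def)
    ultimately show "continuous_map (prod_topology (T n) euclidean) euclidean (\<lambda>(u, x). act u x)"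
      using continuous_map_compose by (fastforce simp: o_def)
  qed
  have sets: "sets \<nu> = sets borel" using prob by (simp add: borel_probability_measure_def)
  interpret averaged_chain K m act \<nu>
  proof (rule averaged_chain.intro)
    fix n k :: nat
    show "averaged_action (K n) (m n) act" by (rule averaged)
    show "carrier (K k) \<subseteq> carrier (K n)" if "k \<le> n" by (rule chain_mono(1)[OF chain that])
    show "borel_probability_measure \<nu>" by (rule prob)
  next
    fix n u assume u: "u \<in> carrier (K n)"
    interpret an: averaged_action "K n" "m n" act by (rule averaged)
    have meas: "act u \<in> \<nu> \<rightarrow>\<^sub>M borel"
      using an.act_single_measurable[OF u] measurable_cong_sets[OF sets refl] by blast
    show "distr \<nu> borel (act u) = \<nu>"
    proof (rule measure_eqI)
      fix A assume "A \<in> sets (distr \<nu> borel (act u))"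
      then have A: "A \<in> sets borel" by simp
      \<comment> \<open>Invariance of \<open>\<nu>\<close> is stated for images; a preimage under
        \<open>u\<close> is an image under its inverse.\<close>
      have "act u -` A \<inter> space \<nu> = act (inv\<^bsub>K n\<^esub> u) ` A"
        using an.act_vimage_eq_image[OF u] sets_eq_imp_space_eq[OF sets] by simp
      moreover have "inv\<^bsub>K n\<^esub> u \<in> carrier ?L" using u by (auto simp: carrier)
      ultimately show "emeasure (distr \<nu> borel (act u)) A = emeasure \<nu> A"
        using invariant A unfolding invariant_measure_def by (simp add: emeasure_distr[OF meas A] sets)
    qed (simp add: sets)
  next
    fix Y :: "'x set"
    assume Y: "Y \<in> sets borel" and Y_invar: "\<And>n u x. u \<in> carrier (K n) \<Longrightarrow> act u x \<in> Y \<longleftrightarrow> x \<in> Y"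
    \<comment> \<open>For an exactly invariant set the symmetric difference in
      \<open>ergodic_measure\<close> is empty, so ergodicity yields the zero-one law.\<close>
    have "act u ` Y = Y" if "u \<in> carrier ?L" for u
    proof -
      obtain n where u: "u \<in> carrier (K n)" using \<open>u \<in> carrier ?L\<close> by (auto simp: carrier)
      interpret an: averaged_action "K n" "m n" act by (rule averaged)
      have "act u ` Y = act (inv\<^bsub>K n\<^esub> u) -` Y"
        using an.act_vimage_eq_image[of "inv\<^bsub>K n\<^esub> u" Y] u by simp
      also have "\<dots> = Y" using Y_invar[of "inv\<^bsub>K n\<^esub> u" n] u by auto
      finally show ?thesis .
    qed
    then show "measure \<nu> Y = 0 \<or> measure \<nu> Y = 1"
      using ergodic Y unfolding ergodic_measure_def by (simp add: sets)
  qed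
  obtain F :: "nat \<Rightarrow> 'x \<Rightarrow> real" where
    F_cont: "\<And>i. continuous_on UNIV (F i)" and F_bdd: "\<And>i. bounded (range (F i))" and
    F_test: "\<And>\<nu>s \<nu>. \<lbrakk>\<And>n. borel_probability_measure (\<nu>s n); borel_probability_measure \<nu>;
        \<And>i. (\<lambda>n. integral\<^sup>L (\<nu>s n) (F i)) \<longlonglongrightarrow> integral\<^sup>L \<nu> (F i)\<rbrakk> \<Longrightarrow> weakly_converges \<nu>s \<nu>"
    using countable_weak_convergence_test[OF separable] by metis
  have F_meas [measurable]: "F i \<in> borel_measurable borel" for i
    by (rule borel_measurable_continuous_onI[OF F_cont])
  have orbit_meas: "(\<lambda>u. act u x) \<in> m n \<rightarrow>\<^sub>M borel" for n x by measurable
  have orbital_prob: "borel_probability_measure (orbital_measure (m n) act x)" for n x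
    unfolding borel_probability_measure_def orbital_measure_def
    by (simp add: step.m.prob_space_distr[OF orbit_meas])
  have orbital_integral: "integral\<^sup>L (orbital_measure (m n) act x) (F i) = step.average n (F i) x" for n x i
    unfolding orbital_measure_def step.average_def by (rule integral_distr) simp_all
  define S where "S = {x. weakly_converges (\<lambda>n. orbital_measure (m n) act x) \<nu>}"
  \<comment> \<open>The test family turns weak convergence into countably many scalar limits. This
    makes \<open>S\<close> Borel and lets the almost sure convergence for each \<open>F i\<close> be
    combined into full measure of \<open>S\<close>.\<close>
  have S_iff: "x \<in> S \<longleftrightarrow> (\<forall>i. (\<lambda>n. step.average n (F i) x) \<longlonglongrightarrow> integral\<^sup>L \<nu> (F i))" for x
  proof
    assume "x \<in> S"
    then show "\<forall>i. (\<lambda>n. step.average n (F i) x) \<longlonglongrightarrow> integral\<^sup>L \<nu> (F i)"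
      using F_cont F_bdd unfolding S_def weakly_converges_def by (auto simp: orbital_integral[symmetric])
  next
    assume "\<forall>i. (\<lambda>n. step.average n (F i) x) \<longlonglongrightarrow> integral\<^sup>L \<nu> (F i)"
    then show "x \<in> S"
      unfolding S_def using orbital_prob prob by (auto intro!: F_test simp: orbital_integral)
  qed
  have "S = {x. \<forall>i j. \<exists>N. \<forall>n\<ge>N. \<bar>step.average n (F i) x - integral\<^sup>L \<nu> (F i)\<bar> \<le> inverse (real (Suc j))}"
    by (auto simp: S_iff LIMSEQ_iff_inverse_Suc eventually_sequentially)
  also have "\<dots> \<in> sets borel" by measurable
  finally have S_sets: "S \<in> sets \<nu>" by (simp add: sets)
  have "AE x in \<nu>. (\<lambda>n. step.average n (F i) x) \<longlonglongrightarrow> integral\<^sup>L \<nu> (F i)" for i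
  proof -
    obtain b where "\<And>x. \<bar>F i x\<bar> \<le> b" using F_bdd[of i] unfolding bounded_iff by auto
    then show ?thesis by (rule AE_average_tendsto[OF F_meas])
  qed
  then have "AE x in \<nu>. x \<in> S" by (simp add: S_iff AE_all_countable)
  then have "measure \<nu> S = 1" using \<nu>.prob_eq_1[OF S_sets] by simp
  moreover from this have "S \<noteq> {}" by auto
  ultimately show ?thesis using S_sets unfolding S_def by blast
qed

end
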